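(* Let $F\in\mathcal F_1(I)$ be strictly increasing with $\max F(x)<x$ for all $x\in(a,b)$ and $\max F(b)\le b$. Let $K=(a,c_1)$ be the absorbing interval of $F$ and let $n\ge 1$ be an integer. Then every iterative root $f\in\mathcal F(I)$ of order $n$ of $F$ on $I\setminus J(F)$ (i.e. $f\in\mathcal F(I)$ with $f^n(x)=F(x)$ for all $x\in I\setminus J(F)$) is, on $I\setminus J(F)$, an extension of an increasing iterative root of $F$ of order $n$ on $K$; that is, $f(K)\subset K$, and $f|_K$ is a strictly increasing single-valued self-map of $K$ with $(f|_K)^n=F|_K$.
   Context: Let $I=[a,b]\subset\mathbb R$, $a<b$. A multifunction $F:I\to 2^I$ assigns to each $x\in I$ a nonempty subset $F(x)\subset I$ (singletons are identified with their elements); $F(A)=\bigcup_{x\in A}F(x)$, $(G\circ F)(x)=G(F(x))$, $F^0(x)=\{x\}$, $F^n=F\circ F^{n-1}$. $F$ is upper semi-continuous (usc) at $x_0\in I$ if for every open $V\subset\mathbb R$ with $F(x_0)\subset V$ there is a neighborhood $U$ of $x_0$ such that $F(x)\subset V$ for all $x\in U\cap I$; usc means usc at every point. $F$ is strictly increasing (resp. strictly decreasing) if $\max F(x)<\min F(y)$ (resp. $\min F(x)>\max F(y)$) whenever $x,y\in I$, $x<y$; strictly monotone means one of these. $\mathcal F(I)$ is the class of strictly monotone usc multifunctions $I\to 2^I$. A jump of $F$ is a point $x_0\in I$ with $\#F(x_0)\ge 2$; $J(F)$ is the set of jumps. For $F\in\mathcal F(I)$ with finitely many jumps, the intensity $\zeta(F)$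 is the least integer $k\ge 0$ with $\#J(F^k)=\#J(F^{k+1})$ (and $+\infty$ if there is none). $\mathcal F_1(I)$ is the set of $F\in\mathcal F(I)$ with finitely many jumps and $\zeta(F)=1$. For $F\in\mathcal F_1(I)$ write $J(F)=\{c_1,\dots,c_m\}$ with the standing convention $a=:c_0<c_1<\dots<c_m<c_{m+1}:=b$, put $I_i:=(c_i,c_{i+1})$ and $I(F):=\{I_i: i=0,\dots,m\}$. Under the hypotheses on $F$ in the claim, $K=(a,c_1)$ is the unique $J\in I(F)$ with $F(J)\subset J$, called the absorbing interval of $F$. *)

theory Defs
  imports Complex_Main "HOL-Library.Extended_Nat"
begin

text \<open>
  A multifunction \<open>I \<rightarrow> 2\<^sup>I\<close> is a function \<open>F :: real \<Rightarrow> real set\<close> of which only the values at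
  points of \<open>I\<close> matter.
\<close>

definition multifunction :: "real set \<Rightarrow> (real \<Rightarrow> real set) \<Rightarrow> bool" where
  "multifunction I F \<longleftrightarrow> (\<forall>x\<in>I. F x \<noteq> {} \<and> F x \<subseteq> I)"

definition mf_image :: "(real \<Rightarrow> real set) \<Rightarrow> real set \<Rightarrow> real set" where
  "mf_image F A = (\<Union>x\<in>A. F x)"

primrec mf_iter :: "(real \<Rightarrow> real set) \<Rightarrow> nat \<Rightarrow> real \<Rightarrow> real set" where
  "mf_iter F 0 x = {x}"
| "mf_iter F (Suc n) x = mf_image F (mf_iter F n x)"

definition usc_at :: "real set \<Rightarrow> (real \<Rightarrow> real set) \<Rightarrow> real \<Rightarrow> bool" where
  "usc_at I F x0 \<longleftrightarrow>
     (\<forall>V. open V \<and> F x0 \<subseteq> V \<longrightarrow> (\<exists>U. open U \<and> x0 \<in> U \<and> (\<forall>x\<in>U \<inter> I. F x \<subseteq> V)))"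

definition usc :: "real set \<Rightarrow> (real \<Rightarrow> real set) \<Rightarrow> bool" where
  "usc I F \<longleftrightarrow> (\<forall>x\<in>I. usc_at I F x)"

text \<open>
  The values are arbitrary nonempty sets, so maxima and minima are treated relationally: a
  condition mentioning \<open>max F(x)\<close> includes the existence of that maximum. (The operators
  \<^const>\<open>Max\<close> and \<^const>\<open>Min\<close> are meaningful for finite sets only.)
\<close>

definition is_max :: "real set \<Rightarrow> real \<Rightarrow> bool" where
  "is_max S M \<longleftrightarrow> M \<in> S \<and> (\<forall>s\<in>S. s \<le> M)"

definition is_min :: "real set \<Rightarrow> real \<Rightarrow> bool" where
  "is_min S m \<longleftrightarrow> m \<in> S \<and> (\<forall>s\<in>S. m \<le> s)"

definition mf_strict_incr :: "real set \<Rightarrow> (real \<Rightarrow> real set) \<Rightarrow> bool" where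
  "mf_strict_incr I F \<longleftrightarrow>
     (\<forall>x\<in>I. \<forall>y\<in>I. x < y \<longrightarrow> (\<exists>M m. is_max (F x) M \<and> is_min (F y) m \<and> M < m))"

definition mf_strict_decr :: "real set \<Rightarrow> (real \<Rightarrow> real set) \<Rightarrow> bool" where
  "mf_strict_decr I F \<longleftrightarrow>
     (\<forall>x\<in>I. \<forall>y\<in>I. x < y \<longrightarrow> (\<exists>m M. is_min (F x) m \<and> is_max (F y) M \<and> m > M))"

definition mf_class :: "real set \<Rightarrow> (real \<Rightarrow> real set) set" where
  "mf_class I =
     {F. multifunction I F \<and> usc I F \<and> (mf_strict_incr I F \<or> mf_strict_decr I F)}"

text \<open>At least two elements; not phrased by \<^const>\<open>card\<close>, which is \<open>0\<close> on infinite sets.\<close>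

definition jumps :: "real set \<Rightarrow> (real \<Rightarrow> real set) \<Rightarrow> real set" where
  "jumps I F = {x \<in> I. \<exists>u\<in>F x. \<exists>v\<in>F x. u \<noteq> v}"

text \<open>
  The intensity is used only for strictly monotone \<open>F\<close> with finitely many jumps. Then distinct
  points have disjoint values, so every iterate has finitely many jumps and \<^const>\<open>card\<close> is the
  true number of jumps.
\<close>

definition intensity :: "real set \<Rightarrow> (real \<Rightarrow> real set) \<Rightarrow> enat" where
  "intensity I F =
     (let P = (\<lambda>k. card (jumps I (mf_iter F k)) = card (jumps I (mf_iter F (Suc k))))
      in if \<exists>k. P k then enat (LEAST k. P k) else \<infinity>)"

definition mf_class1 :: "real set \<Rightarrow> (real \<Rightarrow> real set) set" where
  "mf_class1 I = {F \<in> mf_class I. finite (jumps I F) \<and> intensity I F = 1}"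

text \<open>
  \<open>c\<^sub>1 < \<dots> < c\<^sub>m\<close> are the jumps, \<open>c\<^sub>0 = a\<close> and \<open>c\<^sub>m\<^sub>+\<^sub>1 = b\<close>; in particular all jumps are
  interior points of \<open>[a, b]\<close>.
\<close>

definition jump_enumeration ::
    "real \<Rightarrow> real \<Rightarrow> (real \<Rightarrow> real set) \<Rightarrow> nat \<Rightarrow> (nat \<Rightarrow> real) \<Rightarrow> bool" where
  "jump_enumeration a b F m c \<longleftrightarrow>
     c 0 = a \<and> c (m + 1) = b \<and> strict_mono_on {0..m + 1} c \<and> jumps {a..b} F = c ` {1..m}"

definition jump_intervals :: "nat \<Rightarrow> (nat \<Rightarrow> real) \<Rightarrow> real set set" where
  "jump_intervals m c = (\<lambda>i. {c i<..<c (i + 1)}) ` {0..m}"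

definition absorbing_interval ::
    "(real \<Rightarrow> real set) \<Rightarrow> nat \<Rightarrow> (nat \<Rightarrow> real) \<Rightarrow> real set \<Rightarrow> bool" where
  "absorbing_interval F m c K \<longleftrightarrow>
     K \<in> jump_intervals m c \<and> mf_image F K \<subseteq> K \<and>
     (\<forall>J\<in>jump_intervals m c. mf_image F J \<subseteq> J \<longrightarrow> J = K)"

definition mf_iterative_root_on ::
    "real set \<Rightarrow> real set \<Rightarrow> nat \<Rightarrow> (real \<Rightarrow> real set) \<Rightarrow> (real \<Rightarrow> real set) \<Rightarrow> bool" where
  "mf_iterative_root_on I S n F f \<longleftrightarrow>
     f \<in> mf_class I \<and> (\<forall>x\<in>S. mf_iter f n x = F x)"

text \<open>
  A strictly increasing single-valued self-map \<open>g\<close> of \<open>K\<close> whose \<open>n\<close>-th iterate is the restriction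
  of \<open>F\<close> to \<open>K\<close>, singletons being identified with their elements.
\<close>

definition increasing_root_on ::
    "real set \<Rightarrow> nat \<Rightarrow> (real \<Rightarrow> real set) \<Rightarrow> (real \<Rightarrow> real) \<Rightarrow> bool" where
  "increasing_root_on K n F g \<longleftrightarrow>
     g ` K \<subseteq> K \<and> strict_mono_on K g \<and> (\<forall>x\<in>K. F x = {(g ^^ n) x})"

end

theory Submission
  imports Defs
begin

text \<open>
  Since \<open>max F(x) < x\<close> on \<open>(a, b)\<close>, \<open>F\<close> maps \<open>K = (a, c\<^sub>1)\<close> into itself; intensity one enters
  only through the existence of a jump, so that \<open>c\<^sub>1 < b\<close>. No other \<open>I\<^sub>i\<close> is mapped into itself:
  by upper semi-continuity at \<open>c\<^sub>i\<close>, the values just to the right of \<open>c\<^sub>i\<close> lie below \<open>c\<^sub>i\<close>.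
  A root \<open>f\<close> is single-valued off the jumps of \<open>F\<close>, since distinct points have disjoint nonempty
  iterates under \<open>f\<close>. If \<open>f\<close> were decreasing, then for some \<open>x \<in> K\<close> the point \<open>f(x)\<close> would be an
  interior non-jump, and \<open>F(f(x)) = f(F(x)) > f(x)\<close>, which is absurd. So \<open>f\<close> is increasing, and \<open>f(x) \<ge> x\<close> would give
  \<open>F(x) = f\<^sup>n(x) \<ge> x\<close>.
\<close>

lemma mf_strict_incrD:
  "\<lbrakk>mf_strict_incr I F; x \<in> I; y \<in> I; x < y; u \<in> F x; v \<in> F y\<rbrakk> \<Longrightarrow> u < v"
  unfolding mf_strict_incr_def is_max_def is_min_def by fastforce

lemma mf_strict_decrD:
  "\<lbrakk>mf_strict_decr I F; x \<in> I; y \<in> I; x < y; u \<in> F x; v \<in> F y\<rbrakk> \<Longrightarrow> v < u"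
  unfolding mf_strict_decr_def is_max_def is_min_def by fastforce

text \<open>Either kind of strict monotonicity separates the values at distinct points, so a common
  element forces the points to coincide.\<close>

lemma mf_class_disjoint:
  assumes "F \<in> mf_class I" "x \<in> I" "y \<in> I" "u \<in> F x" "u \<in> F y"
  shows "x = y"
proof -
  have "mf_strict_incr I F \<or> mf_strict_decr I F"
    using assms(1) by (simp add: mf_class_def)
  then show ?thesis
    using mf_strict_incrD mf_strict_decrD assms(2-) by (metis less_irrefl linorder_neqE)
qed

text \<open>The recursion applies \<open>F\<close> last; here the first application is split off
  instead, which yields both the persistence of jumps under iteration and the commutation of a root
  with \<open>F\<close>.\<close>

lemma mf_iter_Suc_right: "mf_iter F (Suc n) x = mf_image (mf_iter F n) (F x)"
  by (induction n) (simp_all add: mf_image_def)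

lemma mf_iter_nonempty_subset:
  assumes "multifunction I F" "x \<in> I"
  shows "mf_iter F n x \<noteq> {} \<and> mf_iter F n x \<subseteq> I"
proof (induction n)
  case (Suc n)
  then obtain y where "y \<in> mf_iter F n x"
    by blast
  then have "F y \<subseteq> mf_iter F (Suc n) x" "F y \<noteq> {}"
    using Suc assms(1) by (auto simp: mf_image_def multifunction_def)
  moreover have "mf_iter F (Suc n) x \<subseteq> I"
    using Suc assms(1) by (auto simp: mf_image_def multifunction_def subset_iff)
  ultimately show ?case
    by blast
qed (use assms in simp)

lemma mf_iter_disjoint:
  assumes F: "F \<in> mf_class I" and I: "x \<in> I" "y \<in> I"
    and u: "u \<in> mf_iter F n x" "u \<in> mf_iter F n y"
  shows "x = y"
  using u
proof (induction n arbitrary: u)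
  case (Suc n)
  then obtain v w where vw: "v \<in> mf_iter F n x" "w \<in> mf_iter F n y" "u \<in> F v" "u \<in> F w"
    by (auto simp: mf_image_def)
  have "multifunction I F"
    using F by (simp add: mf_class_def)
  then have "v \<in> I" "w \<in> I"
    using vw I mf_iter_nonempty_subset by blast+
  then have "v = w"
    using vw F mf_class_disjoint by blast
  then show ?case
    using Suc.IH vw by blast
qed simp

text \<open>Two distinct elements of \<open>F x\<close> have nonempty disjoint \<open>n\<close>-th
  iterates, so the splitting persists. Read contrapositively, a root is single-valued wherever its
  iterate is.\<close>

lemma jumps_subset_jumps_iter:
  assumes F: "F \<in> mf_class I"
  shows "jumps I F \<subseteq> jumps I (mf_iter F (Suc n))"
proof
  fix x assume "x \<in> jumps I F"
  then obtain u v where x: "x \<in> I" and uv: "u \<in> F x" "v \<in> F x" "u \<noteq> v"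
    by (auto simp: jumps_def)
  have mf: "multifunction I F"
    using F by (simp add: mf_class_def)
  then have I: "u \<in> I" "v \<in> I"
    using x uv by (auto simp: multifunction_def)
  then obtain p q where pq: "p \<in> mf_iter F n u" "q \<in> mf_iter F n v"
    using mf_iter_nonempty_subset[OF mf I(1), of n] mf_iter_nonempty_subset[OF mf I(2), of n]
    by (meson ex_in_conv)
  then have "p \<noteq> q"
    using mf_iter_disjoint[OF F I] uv(3) by blast
  moreover have "p \<in> mf_iter F (Suc n) x" "q \<in> mf_iter F (Suc n) x"
    unfolding mf_iter_Suc_right mf_image_def using uv pq by blast+
  ultimately show "x \<in> jumps I (mf_iter F (Suc n))"
    unfolding jumps_def using x by blast
qed

lemma mf_singleton_if_not_jump:
  assumes "multifunction I F" "x \<in> I" "x \<notin> jumps I F"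
  shows "\<exists>y\<in>I. F x = {y}"
proof -
  obtain y where y: "y \<in> F x" "y \<in> I"
    using assms(1,2) unfolding multifunction_def by blast
  then have "F x = {y}"
    using assms(2,3) unfolding jumps_def by blast
  then show ?thesis
    using y(2) by blast
qed

text \<open>Without jumps, the iterates of order 0 and 1 would have equally many jumps, namely none,
  and the intensity would be 0.\<close>

lemma mf_class1_jumps_nonempty:
  assumes "F \<in> mf_class1 I"
  shows "jumps I F \<noteq> {}"
proof
  assume "jumps I F = {}"
  moreover have "mf_iter F (Suc 0) = F"
    by (auto simp: mf_image_def)
  moreover have "jumps I (mf_iter F 0) = {}"
    by (auto simp: jumps_def)
  ultimately have "card (jumps I (mf_iter F 0)) = card (jumps I (mf_iter F (Suc 0)))"
    by presburger
  then have "intensity I F = 0"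
    unfolding intensity_def Let_def by (auto simp: zero_enat_def intro: Least_eq_0)
  then show False
    using assms by (simp add: mf_class1_def)
qed

text \<open>If \<open>w \<ge> x\<close>, monotonicity keeps \<open>f w\<close> from falling below
  \<open>x\<close>, so an orbit that starts upwards never drops under its starting point.\<close>

lemma mf_iter_ge:
  assumes inc: "mf_strict_incr I f" and mf: "multifunction I f" and x: "x \<in> I"
    and ge: "\<forall>u\<in>f x. x \<le> u" and z: "z \<in> mf_iter f n x"
  shows "x \<le> z"
  using z
proof (induction n arbitrary: z)
  case (Suc n)
  then obtain w where w: "w \<in> mf_iter f n x" "z \<in> f w"
    by (auto simp: mf_image_def)
  have wI: "w \<in> I"
    using mf_iter_nonempty_subset[OF mf x] w by blast
  obtain u where u: "u \<in> f x"
    using mf x by (auto simp: multifunction_def)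
  have "x \<le> w"
    using Suc.IH w by blast
  then show ?case
    using mf_strict_incrD[OF inc x wI _ u w(2)] ge u w(2) by (cases "x = w") fastforce+
qed simp

lemma mf_iter_eq_funpow:
  assumes "\<forall>x\<in>K. f x = {g x}" "g ` K \<subseteq> K" "x \<in> K"
  shows "mf_iter f n x = {(g ^^ n) x} \<and> (g ^^ n) x \<in> K"
  using assms by (induction n) (auto simp: mf_image_def)

theorem theorem3p1:
  fixes a b :: real and F :: "real \<Rightarrow> real set" and m n :: nat and c :: "nat \<Rightarrow> real"
    and K :: "real set"
  assumes "a < b"
    and "F \<in> mf_class1 {a..b}"
    and "mf_strict_incr {a..b} F"
    and "\<forall>x\<in>{a<..<b}. \<exists>M. is_max (F x) M \<and> M < x"
    and "\<exists>M. is_max (F b) M \<and> M \<le> b"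
    and "jump_enumeration a b F m c"
    and "K = {a<..<c 1}"
    and "n \<ge> 1"
  shows "absorbing_interval F m c K \<and>
    (\<forall>f. mf_iterative_root_on {a..b} ({a..b} - jumps {a..b} F) n F f \<longrightarrow>
       mf_image f K \<subseteq> K \<and>
       (\<exists>g. increasing_root_on K n F g \<and> (\<forall>x\<in>K. f x = {g x})))"
proof -
  let ?I = "{a..b}"
  let ?J = "jumps ?I F"
  have F: "F \<in> mf_class ?I" and finJ: "finite ?J"
    using assms(2) by (auto simp: mf_class1_def)
  then have mfF: "multifunction ?I F" and uscF: "usc ?I F"
    by (auto simp: mf_class_def)
  have c0: "c 0 = a" and cm: "c (m + 1) = b" and mono: "strict_mono_on {0..m + 1} c"
    and J: "?J = c ` {1..m}"
    using assms(6) by (auto simp: jump_enumeration_def)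
  have "m \<noteq> 0"
    using mf_class1_jumps_nonempty[OF assms(2)] J by auto
  then have m: "m \<ge> 1"
    by simp
  have cless: "c i < c j" if "i < j" "j \<le> m + 1" for i j
    using strict_mono_onD[OF mono] that by simp
  have ac1: "a < c 1" and c1b: "c 1 < b"
    using cless[of 0 1] cless[of 1 "m + 1"] c0 cm m by auto
  have KI: "x \<in> ?I \<and> a < x \<and> x < b \<and> x \<notin> ?J" if "x \<in> K" for x
  proof -
    \<comment> \<open>\<open>c 1\<close> is the least jump, so \<open>K\<close> contains
      none.\<close>
    have "c 1 \<le> c i" if "i \<in> {1..m}" for i
      using cless[of 1 i] that by (cases "i = 1") auto
    then show ?thesis
      using that c1b assms(7) J by fastforce
  qed
  have below: "y < x" if "a < x" "x < b" "y \<in> F x" for x y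
    using assms(4) that unfolding is_max_def
    by (meson greaterThanLessThan_iff le_less_trans)
  \<comment> \<open>Values at \<open>a\<close> are at least \<open>a\<close>, hence values further
    right exceed \<open>a\<close>. Stated for arbitrary \<open>f\<close>, since it serves both
    \<open>F\<close> and its root.\<close>
  have above: "a < y" if f: "mf_strict_incr ?I f" "multifunction ?I f" and x: "x \<in> ?I" "a < x" "y \<in> f x"
    for f x y
  proof -
    have aI: "a \<in> ?I"
      using assms(1) by simp
    obtain u where "u \<in> f a" "a \<le> u"
      using f(2) aI unfolding multifunction_def by fastforce
    then show ?thesis
      using mf_strict_incrD[OF f(1) aI x(1,2) _ x(3)] by fastforce
  qed
  have FK: "mf_image F K \<subseteq> K"
  proof
    fix y assume "y \<in> mf_image F K"
    then obtain x where x: "x \<in> K" "y \<in> F x"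
      by (auto simp: mf_image_def)
    then show "y \<in> K"
      using above[OF assms(3) mfF, of x y] below[of x y] KI[of x] assms(7) by auto
  qed
  have not_absorbing: "\<not> mf_image F {c i<..<c (i + 1)} \<subseteq> {c i<..<c (i + 1)}"
    if i: "i \<in> {1..m}" for i
  proof
    assume sub: "mf_image F {c i<..<c (i + 1)} \<subseteq> {c i<..<c (i + 1)}"
    have ci: "a < c i" "c i < b" "c i < c (i + 1)"
      using cless[of 0 i] cless[of i "m + 1"] cless[of i "i + 1"] c0 cm i by auto
    have cib: "c (i + 1) \<le> b"
      using cless[of "i + 1" "m + 1"] cm i by (cases "i = m") auto
    \<comment> \<open>As \<open>c i\<close> is interior, the open half-line below it contains
      \<open>F (c i)\<close> and is a legitimate test set for upper semi-continuity.\<close>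
    have "F (c i) \<subseteq> {..<c i}"
      using below ci by auto
    moreover have "usc_at ?I F (c i)"
      using uscF ci by (auto simp: usc_def)
    ultimately obtain U where U: "open U" "c i \<in> U" "\<forall>x\<in>U \<inter> ?I. F x \<subseteq> {..<c i}"
      unfolding usc_at_def using open_lessThan[of "c i"] by metis
    obtain e where e: "e > c i" "{c i..<e} \<subseteq> U"
      using open_right[OF U(1,2) ci(3)] by blast
    \<comment> \<open>The bound \<open>min e (c (i + 1))\<close> keeps \<open>x\<close> both in the
      neighborhood \<open>U\<close> and in the interval.\<close>
    obtain x where x: "c i < x" "x < min e (c (i + 1))"
      using dense[of "c i" "min e (c (i + 1))"] e ci by auto
    then have xI: "x \<in> U \<inter> ?I"
      using e ci cib by auto
    then obtain y where y: "y \<in> F x"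
      using mfF unfolding multifunction_def by blast
    then have "y < c i"
      using U(3) xI by auto
    moreover have "y \<in> mf_image F {c i<..<c (i + 1)}"
      using y x by (auto simp: mf_image_def)
    ultimately show False
      using sub by fastforce
  qed
  have K0: "K = {c 0<..<c (0 + 1)}"
    using assms(7) c0 by simp
  have "X = K" if X: "X \<in> jump_intervals m c" "mf_image F X \<subseteq> X" for X
  proof -
    obtain i where "i \<in> {0..m}" "X = {c i<..<c (i + 1)}"
      using X(1) by (auto simp: jump_intervals_def)
    then show ?thesis
      using not_absorbing[of i] X(2) K0 by (cases "i = 0") auto
  qed
  moreover have "K \<in> jump_intervals m c"
    unfolding jump_intervals_def K0 by (rule imageI) simp
  ultimately have abs: "absorbing_interval F m c K"
    unfolding absorbing_interval_def using FK by blast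
  have "mf_image f K \<subseteq> K \<and> (\<exists>g. increasing_root_on K n F g \<and> (\<forall>x\<in>K. f x = {g x}))"
    if "mf_iterative_root_on ?I (?I - ?J) n F f" for f
  proof -
    have f: "f \<in> mf_class ?I" and root: "\<And>x. x \<in> ?I \<Longrightarrow> x \<notin> ?J \<Longrightarrow> mf_iter f n x = F x"
      using that by (auto simp: mf_iterative_root_on_def)
    then have mff: "multifunction ?I f" and monof: "mf_strict_incr ?I f \<or> mf_strict_decr ?I f"
      by (auto simp: mf_class_def)
    obtain n' where n': "n = Suc n'"
      using assms(8) by (cases n) auto
    have "\<exists>y\<in>?I. f x = {y}" if x: "x \<in> ?I" "x \<notin> ?J" for x
    proof -
      have "x \<notin> jumps ?I (mf_iter f n)"
        using x root by (auto simp: jumps_def)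
      then have "x \<notin> jumps ?I f"
        using jumps_subset_jumps_iter[OF f, of n'] n' by blast
      then show ?thesis
        using mf_singleton_if_not_jump[OF mff x(1)] by blast
    qed
    then obtain g where gf: "\<And>x. x \<in> ?I \<Longrightarrow> x \<notin> ?J \<Longrightarrow> g x \<in> ?I \<and> f x = {g x}"
      by metis
    have "\<not> mf_strict_decr ?I f"
    proof
      assume dec: "mf_strict_decr ?I f"
      have "inj_on g K"
        using mf_class_disjoint[OF f] gf KI by (intro inj_onI) (metis singletonI)
      moreover have "infinite K"
        using ac1 assms(7) by simp
      ultimately have "infinite (g ` K)"
        by (simp add: finite_image_iff)
      then obtain x where x: "x \<in> K" and gx: "g x \<notin> ?J \<union> {a, b}"
        using finJ finite_subset[of "g ` K" "?J \<union> {a, b}"] by auto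
      have xI: "x \<in> ?I" "x \<notin> ?J" "f x = {g x}" "g x \<in> ?I"
        using KI x gf by auto
      \<comment> \<open>Both sides are the iterate of order \<open>n + 1\<close> of \<open>f\<close>
        at \<open>x\<close>, once with \<open>f\<close> applied first and once with \<open>f\<close>
        applied last.\<close>
      have "mf_iter f n (g x) = mf_image f (F x)"
        using mf_iter_Suc_right[of f n x] root[OF xI(1,2)] xI(3) by (simp add: mf_image_def)
      then have Fgx: "F (g x) = mf_image f (F x)"
        using root[of "g x"] xI gx by simp
      obtain y where y: "y \<in> F x"
        using mfF xI unfolding multifunction_def by blast
      have yK: "y \<in> K"
        using FK x y by (auto simp: mf_image_def)
      have "y < x"
        using below KI x y by blast
      \<comment> \<open>A decreasing \<open>f\<close> reverses \<open>y < x\<close>, yet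
        \<open>g y\<close> belongs to \<open>F (g x)\<close> and must lie below
        \<open>g x\<close>.\<close>
      then have "g x < g y"
        using mf_strict_decrD[OF dec, of y x "g y" "g x"] gf[of y] KI[OF yK] xI by auto
      moreover have "g y \<in> F (g x)"
        unfolding Fgx mf_image_def using y gf[of y] KI[OF yK] by auto
      ultimately show False
        using below[of "g x" "g y"] gx xI(4) by auto
    qed
    then have inc: "mf_strict_incr ?I f"
      using monof by blast
    have gK: "g x \<in> K" if x: "x \<in> K" for x
    proof -
      have xI: "x \<in> ?I" "x \<notin> ?J" "a < x" "x < b" "f x = {g x}"
        using KI x gf by auto
      \<comment> \<open>Otherwise every element of the \<open>n\<close>-th iterate of
        \<open>f\<close> at \<open>x\<close>, which is \<open>F x\<close>, would be at least
        \<open>x\<close>.\<close>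
      have "g x < x"
      proof (rule ccontr)
        assume "\<not> g x < x"
        moreover obtain y where y: "y \<in> F x"
          using mfF xI unfolding multifunction_def by blast
        ultimately have "x \<le> y"
          using mf_iter_ge[OF inc mff xI(1), of y n] root[OF xI(1,2)] xI(5) by auto
        then show False
          using below[OF xI(3,4) y] by simp
      qed
      moreover have "a < g x"
        using above[OF inc mff xI(1,3)] xI(5) by simp
      ultimately show ?thesis
        using x assms(7) by auto
    qed
    have fg: "\<forall>x\<in>K. f x = {g x}"
      using gf KI by blast
    have "strict_mono_on K g"
    proof (rule strict_mono_onI)
      fix x y assume "x \<in> K" "y \<in> K" "x < y"
      then show "g x < g y"
        using mf_strict_incrD[OF inc, of x y "g x" "g y"] fg KI by auto
    qed
    \<comment> \<open>Orbits of \<open>g\<close> stay in \<open>K\<close>, where \<open>f\<close> is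
      the singleton of \<open>g\<close>, so set-valued and pointwise iteration agree.\<close>
    moreover have "F x = {(g ^^ n) x}" if "x \<in> K" for x
      using mf_iter_eq_funpow[OF fg _ that, of n] gK root[of x] KI[OF that] by auto
    ultimately have "increasing_root_on K n F g"
      unfolding increasing_root_on_def using gK by blast
    moreover have "mf_image f K \<subseteq> K"
      using fg gK by (auto simp: mf_image_def)
    ultimately show ?thesis
      using fg by blast
  qed
  then show ?thesis
    using abs by blast
qed

end
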